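(* Let $X$ be a Tychonoff space and let $K_X$ be the set of isolated points of $X$, with $|K_X|\geq 3$. If $K_X$ is finite, then $\chi(G(C_F(X)))=\binom{|K_X|}{\lfloor |K_X|/2\rfloor}$.
   Context: $C(X)$ is the ring of all real valued continuous functions on the Tychonoff (completely regular Hausdorff) space $X$; $Z(f)=\{x\in X: f(x)=0\}$; $C_F(X)=\{f\in C(X): X\setminus Z(f)\text{ is finite}\}$, a commutative ring (possibly without identity). For a commutative ring $R$, $Z(R)^*$ is the set of nonzero zero divisors, i.e. nonzero $a\in R$ with $ab=0$ for some nonzero $b\in R$, and $ann(a)=\{r\in R: ra=0\}$. The annihilator graph $AG(R)$ is the simple graph with vertex set $Z(R)^*$ in which distinct $a,b$ are adjacent iff $ann(a)\cup ann(b)\neq ann(ab)$. On $C_F(X)$ define the equivalence relation $f\sim g$ iff $int_XZ(f)\cap K_X=int_XZ(g)\cap K_X$. Fix a set $S\subset C_F(X)$ containing exactly one element of each equivalence class, and put $V(C_F(X))=\{f\in S\setminus\{0\}: int_XZ(f)\cap K_X\neq\emptyset\}$, which is a subset of $Z(C_F(X))^*$. $G(C_F(X))$ is the induced subgraph of $AG(C_F(X))$ with vertex set $V(C_F(X))$. (One may take $V(C_F(X))=\{1_A: \emptyset\neq A\subsetneqq K_X,\ A\text{ finite}\}$, where $1_A$ is the characteristic function of $A$.) The chromatic number $\chi(H)$ of a graph $H$ is the least cardinal $\Lambda$ such that the vertices of $H$ can be labeled with $\Lambda$ colors so that adjacent vertices receive different colors. *)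

theory Defs
  imports
    "HOL-Analysis.Analysis"
    "HOL-Algebra.Ideal"
    "Graph_Theory.Digraph_Component"
begin

unbundle cardinal_syntax

section \<open>The chromatic number\<close>

text \<open>
  An undirected graph is a symmetric digraph. The labels of a colouring are the elements of the
  field of the cardinal \<open>\<Lambda>\<close>.
\<close>

definition colourable_with :: "('v, 'e) pre_digraph \<Rightarrow> 'c rel \<Rightarrow> bool" where
  "colourable_with G \<Lambda> \<longleftrightarrow>
     (\<exists>c \<in> verts G \<rightarrow> Field \<Lambda>.
        \<forall>u \<in> verts G. \<forall>v \<in> verts G. u \<rightarrow>\<^bsub>G\<^esub> v \<longrightarrow> c u \<noteq> c v)"

text \<open>
  Cardinals on the type of the vertices suffice, since a loop-free graph is coloured by its own
  vertices. Lemma \<open>chromatic_number_least\<close> below shows that the result is minimal among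
  the cardinals on all types.
\<close>

definition chromatic_number :: "('v, 'e) pre_digraph \<Rightarrow> 'v rel" where
  "chromatic_number G =
     (SOME \<Lambda>. Card_order \<Lambda> \<and> colourable_with G \<Lambda> \<and>
        (\<forall>\<Lambda>' :: 'v rel. Card_order \<Lambda>' \<and> colourable_with G \<Lambda>' \<longrightarrow> \<Lambda> \<le>o \<Lambda>'))"

lemma chromatic_number_props:
  fixes G :: "('v, 'e) pre_digraph"
  assumes loopfree: "\<And>v. v \<in> verts G \<Longrightarrow> \<not> v \<rightarrow>\<^bsub>G\<^esub> v"
  shows "Card_order (chromatic_number G)"
    and "colourable_with G (chromatic_number G)"
    and "\<And>\<Lambda>' :: 'v rel. Card_order \<Lambda>' \<Longrightarrow> colourable_with G \<Lambda>' \<Longrightarrow> chromatic_number G \<le>o \<Lambda>'"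
proof -
  let ?R = "{\<Lambda> :: 'v rel. Card_order \<Lambda> \<and> colourable_with G \<Lambda>}"
  have "colourable_with G |verts G|"
    unfolding colourable_with_def using loopfree by (intro bexI[of _ id]) (auto simp: Field_card_of)
  then have "|verts G| \<in> ?R"
    by (simp add: card_of_Card_order)
  then have ne: "?R \<noteq> {}"
    by blast
  have "\<exists>\<Lambda> \<in> ?R. \<forall>\<Lambda>' \<in> ?R. \<Lambda> \<le>o \<Lambda>'"
    by (rule exists_minim_Card_order[OF ne]) simp
  then have "\<exists>\<Lambda> :: 'v rel. Card_order \<Lambda> \<and> colourable_with G \<Lambda> \<and>
        (\<forall>\<Lambda>' :: 'v rel. Card_order \<Lambda>' \<and> colourable_with G \<Lambda>' \<longrightarrow> \<Lambda> \<le>o \<Lambda>')"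
    by blast
  from someI_ex[OF this]
  show "Card_order (chromatic_number G)" "colourable_with G (chromatic_number G)"
    "\<And>\<Lambda>' :: 'v rel. Card_order \<Lambda>' \<Longrightarrow> colourable_with G \<Lambda>' \<Longrightarrow> chromatic_number G \<le>o \<Lambda>'"
    unfolding chromatic_number_def[symmetric] by blast+
qed

lemma chromatic_number_least:
  fixes G :: "('v, 'e) pre_digraph" and \<Lambda> :: "'c rel"
  assumes loopfree: "\<And>v. v \<in> verts G \<Longrightarrow> \<not> v \<rightarrow>\<^bsub>G\<^esub> v"
    and \<Lambda>: "Card_order \<Lambda>" "colourable_with G \<Lambda>"
  shows "chromatic_number G \<le>o \<Lambda>"
proof -
  obtain c where c: "c \<in> verts G \<rightarrow> Field \<Lambda>"
      "\<And>u v. u \<in> verts G \<Longrightarrow> v \<in> verts G \<Longrightarrow> u \<rightarrow>\<^bsub>G\<^esub> v \<Longrightarrow> c u \<noteq> c v"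
    using \<Lambda>(2) unfolding colourable_with_def by blast
  define r where "r = inv_into (verts G) c"
  have r: "c (r (c v)) = c v" if "v \<in> verts G" for v
    using that unfolding r_def by (simp add: f_inv_into_f)
  have "colourable_with G |r ` c ` verts G|"
    unfolding colourable_with_def
  proof (intro bexI[of _ "r \<circ> c"] ballI impI)
    fix u v assume "u \<in> verts G" "v \<in> verts G" "u \<rightarrow>\<^bsub>G\<^esub> v"
    then show "(r \<circ> c) u \<noteq> (r \<circ> c) v"
      using c(2) r by (metis comp_apply)
  qed (auto simp: Field_card_of)
  then have "chromatic_number G \<le>o |r ` c ` verts G|"
    by (intro chromatic_number_props(3) loopfree card_of_Card_order)
  also have "|r ` c ` verts G| \<le>o |c ` verts G|"
    by (rule card_of_image)
  also have "|c ` verts G| \<le>o |Field \<Lambda>|"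
    using c(1) by (intro card_of_mono1) auto
  also have "|Field \<Lambda>| =o \<Lambda>"
    by (rule card_of_Field_ordIso[OF \<Lambda>(1)])
  finally show ?thesis .
qed

section \<open>The annihilator graph of a commutative ring\<close>

text \<open>
  The field \<open>one\<close> of the ring record plays no role in this section, so the definitions also
  cover rings without identity.
\<close>

definition annihilator :: "('a, 'm) ring_scheme \<Rightarrow> 'a \<Rightarrow> 'a set" where
  "annihilator R a = {r \<in> carrier R. r \<otimes>\<^bsub>R\<^esub> a = \<zero>\<^bsub>R\<^esub>}"

definition nonzero_zero_divisors :: "('a, 'm) ring_scheme \<Rightarrow> 'a set" where
  "nonzero_zero_divisors R =
     {a \<in> carrier R. a \<noteq> \<zero>\<^bsub>R\<^esub> \<and> (\<exists>b \<in> carrier R. b \<noteq> \<zero>\<^bsub>R\<^esub> \<and> a \<otimes>\<^bsub>R\<^esub> b = \<zero>\<^bsub>R\<^esub>)}"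

definition annihilator_graph :: "('a, 'm) ring_scheme \<Rightarrow> 'a pair_pre_digraph" where
  "annihilator_graph R =
     \<lparr>pverts = nonzero_zero_divisors R,
      parcs = {(a, b). a \<in> nonzero_zero_divisors R \<and> b \<in> nonzero_zero_divisors R \<and> a \<noteq> b \<and>
                 annihilator R a \<union> annihilator R b \<noteq> annihilator R (a \<otimes>\<^bsub>R\<^esub> b)}\<rparr>"

lemma annihilator_graph_bidirected:
  assumes "\<And>a b. a \<in> carrier R \<Longrightarrow> b \<in> carrier R \<Longrightarrow> a \<otimes>\<^bsub>R\<^esub> b = b \<otimes>\<^bsub>R\<^esub> a"
  shows "pair_bidirected_digraph (annihilator_graph R)"
proof -
  have "a \<otimes>\<^bsub>R\<^esub> b = b \<otimes>\<^bsub>R\<^esub> a"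
    if "a \<in> nonzero_zero_divisors R" "b \<in> nonzero_zero_divisors R" for a b
    using that assms unfolding nonzero_zero_divisors_def by blast
  then show ?thesis
    by unfold_locales (auto simp: annihilator_graph_def symmetric_def sym_def Un_commute)
qed

section \<open>The ring of continuous functions and the functions of finite support\<close>

definition isolated_points :: "'a topology \<Rightarrow> 'a set" where
  "isolated_points X = {x \<in> topspace X. openin X {x}}"

text \<open>
  Functions on \<open>topspace X\<close> are represented extensionally, so that equality of elements of
  the rings below is equality of functions on the space.
\<close>

definition continuous_functions_ring :: "'a topology \<Rightarrow> ('a \<Rightarrow> real) ring" where
  "continuous_functions_ring X =
     \<lparr>carrier = {f \<in> extensional (topspace X). continuous_map X euclideanreal f},
      monoid.mult = (\<lambda>f g. \<lambda>x\<in>topspace X. f x * g x),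
      one = (\<lambda>x\<in>topspace X. 1),
      zero = (\<lambda>x\<in>topspace X. 0),
      add = (\<lambda>f g. \<lambda>x\<in>topspace X. f x + g x)\<rparr>"

definition zero_set :: "'a topology \<Rightarrow> ('a \<Rightarrow> real) \<Rightarrow> 'a set" where
  "zero_set X f = {x \<in> topspace X. f x = 0}"

definition finite_support_functions :: "'a topology \<Rightarrow> ('a \<Rightarrow> real) set" where
  "finite_support_functions X =
     {f \<in> carrier (continuous_functions_ring X). finite (topspace X - zero_set X f)}"

text \<open>
  The field \<open>one\<close> inherited from the ring of all continuous functions need not lie in the
  carrier of the following structure.
\<close>

definition CF_ring :: "'a topology \<Rightarrow> ('a \<Rightarrow> real) ring" where
  "CF_ring X = (continuous_functions_ring X)\<lparr>carrier := finite_support_functions X\<rparr>"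

lemma continuous_map_restrict_topspace [simp]:
  "continuous_map X Y (restrict f (topspace X)) \<longleftrightarrow> continuous_map X Y f"
  by (auto elim: continuous_map_eq)

lemma cring_continuous_functions_ring: "cring (continuous_functions_ring X)"
proof (rule cringI)
  show "abelian_group (continuous_functions_ring X)"
  proof (rule abelian_groupI)
    fix f assume f: "f \<in> carrier (continuous_functions_ring X)"
    show "\<exists>g\<in>carrier (continuous_functions_ring X).
      g \<oplus>\<^bsub>continuous_functions_ring X\<^esub> f = \<zero>\<^bsub>continuous_functions_ring X\<^esub>"
    proof
      have "continuous_map X euclideanreal (\<lambda>x. - f x)"
        using f by (auto simp: continuous_functions_ring_def intro: continuous_intros)
      then show "(\<lambda>x\<in>topspace X. - f x) \<in> carrier (continuous_functions_ring X)"
        by (auto simp: continuous_functions_ring_def)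
    qed (auto simp: continuous_functions_ring_def)
  qed (auto simp: continuous_functions_ring_def fun_eq_iff extensional_def
      intro!: continuous_intros)
  show "comm_monoid (continuous_functions_ring X)"
    by (rule comm_monoidI)
      (auto simp: continuous_functions_ring_def fun_eq_iff extensional_def
        intro!: continuous_intros)
qed (auto simp: continuous_functions_ring_def fun_eq_iff distrib_right)

lemma ideal_finite_support_functions:
  "ideal (finite_support_functions X) (continuous_functions_ring X)"
proof -
  interpret cring "continuous_functions_ring X"
    by (rule cring_continuous_functions_ring)
  have fin: "finite {x \<in> topspace X. h x \<noteq> 0}"
    if "finite {x \<in> topspace X. f x \<noteq> 0}" "finite {x \<in> topspace X. g x \<noteq> 0}"
      "\<And>x. x \<in> topspace X \<Longrightarrow> f x = 0 \<Longrightarrow> g x = 0 \<Longrightarrow> h x = 0"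
    for f g h :: "'a \<Rightarrow> real"
    by (rule finite_subset[OF _ finite_UnI[OF that(1,2)]]) (use that(3) in blast)
  have mem: "f \<in> finite_support_functions X \<longleftrightarrow>
      f \<in> carrier (continuous_functions_ring X) \<and> finite {x \<in> topspace X. f x \<noteq> 0}" for f
  proof -
    have "topspace X - zero_set X f = {x \<in> topspace X. f x \<noteq> 0}"
      by (auto simp: zero_set_def)
    then show ?thesis
      by (simp add: finite_support_functions_def)
  qed
  have minus: "(\<ominus>\<^bsub>continuous_functions_ring X\<^esub> f) x = - f x"
    if "f \<in> carrier (continuous_functions_ring X)" "x \<in> topspace X" for f x
  proof -
    have "(f \<oplus>\<^bsub>continuous_functions_ring X\<^esub> (\<ominus>\<^bsub>continuous_functions_ring X\<^esub> f)) x = 0"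
      using r_neg[OF that(1)] that(2) by (simp add: continuous_functions_ring_def)
    then show ?thesis
      using that(2) by (simp add: continuous_functions_ring_def)
  qed
  have mult: "(f \<otimes>\<^bsub>continuous_functions_ring X\<^esub> g) x = f x * g x"
    and add: "(f \<oplus>\<^bsub>continuous_functions_ring X\<^esub> g) x = f x + g x"
    and zero: "\<zero>\<^bsub>continuous_functions_ring X\<^esub> x = 0"
    if "x \<in> topspace X" for f g x
    using that by (simp_all add: continuous_functions_ring_def)
  show ?thesis
  proof (rule idealI)
    show "subgroup (finite_support_functions X) (add_monoid (continuous_functions_ring X))"
    proof (rule add.subgroupI)
      show "finite_support_functions X \<noteq> {}"
        proof -
        have "\<zero>\<^bsub>continuous_functions_ring X\<^esub> \<in> finite_support_functions X"
          by (simp add: mem zero cong: conj_cong)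
        then show ?thesis by blast
      qed
      show "f \<oplus>\<^bsub>continuous_functions_ring X\<^esub> g \<in> finite_support_functions X"
        if "f \<in> finite_support_functions X" "g \<in> finite_support_functions X" for f g
        using that by (auto simp: mem add intro: fin[of f g])
      show "\<ominus>\<^bsub>continuous_functions_ring X\<^esub> f \<in> finite_support_functions X"
        if "f \<in> finite_support_functions X" for f
        using that by (auto simp: mem minus intro: fin[of f f])
    qed (auto simp: mem)
    show "g \<otimes>\<^bsub>continuous_functions_ring X\<^esub> f \<in> finite_support_functions X"
      and "f \<otimes>\<^bsub>continuous_functions_ring X\<^esub> g \<in> finite_support_functions X"
      if "f \<in> finite_support_functions X" "g \<in> carrier (continuous_functions_ring X)" for f g
      using that by (auto simp: mem mult intro: fin[of f f])
  qed (rule ring_axioms)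
qed

section \<open>The graph on representatives\<close>

definition CF_equiv :: "'a topology \<Rightarrow> ('a \<Rightarrow> real) rel" where
  "CF_equiv X =
     {(f, g). f \<in> finite_support_functions X \<and> g \<in> finite_support_functions X \<and>
        X interior_of (zero_set X f) \<inter> isolated_points X =
        X interior_of (zero_set X g) \<inter> isolated_points X}"

definition CF_representatives :: "'a topology \<Rightarrow> ('a \<Rightarrow> real) set \<Rightarrow> bool" where
  "CF_representatives X S \<longleftrightarrow>
     S \<subseteq> finite_support_functions X \<and>
     (\<forall>E \<in> finite_support_functions X // CF_equiv X. \<exists>!f. f \<in> S \<inter> E)"

definition CF_vertices :: "'a topology \<Rightarrow> ('a \<Rightarrow> real) set \<Rightarrow> ('a \<Rightarrow> real) set" where
  "CF_vertices X S =
     {f \<in> S - {\<zero>\<^bsub>CF_ring X\<^esub>}. X interior_of (zero_set X f) \<inter> isolated_points X \<noteq> {}}"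

definition CF_graph ::
  "'a topology \<Rightarrow> ('a \<Rightarrow> real) set \<Rightarrow>
     ('a \<Rightarrow> real, ('a \<Rightarrow> real) \<times> ('a \<Rightarrow> real)) pre_digraph" where
  "CF_graph X S = with_proj (annihilator_graph (CF_ring X)) \<restriction> CF_vertices X S"

end

theory Submission
  imports Defs
begin

text \<open>
  Write \<open>K\<close> for the set of isolated points and \<open>n\<close> for its size. The set where a continuous
  function is nonzero (its cozero set) is open, and a finite open subset of a \<open>T\<^sub>1\<close> space
  consists of isolated points. So the cozero sets of the functions of finite support are the finite
  subsets of \<open>K\<close>, and a product vanishes iff the cozero sets of its factors are disjoint.
  Everything that the graph depends on is a statement about these sets: two functions are
  equivalent iff they have the same cozero set, so that the vertices correspond to the nonempty
  proper subsets of \<open>K\<close> (\<open>CF_vertices_iff\<close>, \<open>CF_representatives_cozero\<close>); and two of them are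
  adjacent iff neither of their sets contains the other (\<open>CF_graph_adjacent_iff\<close>), because a
  function annihilates \<open>f g\<close> but neither \<open>f\<close> nor \<open>g\<close> iff its cozero set meets those of \<open>f\<close>
  and \<open>g\<close> but not their intersection.

  A colour class is therefore a chain of sets, and a clique is an antichain. The subsets of size
  \<open>n div 2\<close> form a clique of \<open>n choose (n div 2)\<close> vertices, which is the lower bound. For the upper
  bound, the power set of \<open>K\<close> splits into symmetric chains, that is, chains that for some
  \<open>k\<close> contain one set of each size from \<open>k\<close> to \<open>n - k\<close>
  (\<open>symmetric_chain_decomposition\<close>). Each of them passes through size \<open>n div 2\<close>, so there are
  only \<open>n choose (n div 2)\<close> of them, and they serve as the colours
  (\<open>chain_colouring_of_subsets\<close>).
\<close>

section \<open>Symmetric chain decompositions of power sets\<close>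

text \<open>
  A symmetric chain decomposition is encoded by the map \<open>b\<close> that sends a set to the smallest set
  of its chain. The chains are then the fibres of \<open>b\<close>, so their disjointness needs no proof, and
  the sizes that occur in the chain of \<open>A\<close> are those from \<open>card (b A)\<close> to
  \<open>card K - card (b A)\<close>.
\<close>

definition chain_bottoms :: "'a set \<Rightarrow> ('a set \<Rightarrow> 'a set) \<Rightarrow> bool" where
  "chain_bottoms K b \<longleftrightarrow>
    (\<forall>A. A \<subseteq> K \<longrightarrow> b A \<subseteq> A \<and> card A + card (b A) \<le> card K) \<and>
    (\<forall>A B. A \<subseteq> K \<longrightarrow> B \<subseteq> K \<longrightarrow> b A = b B \<longrightarrow> A \<subseteq> B \<or> B \<subseteq> A) \<and>
    (\<forall>A j. A \<subseteq> K \<longrightarrow> card (b A) \<le> j \<longrightarrow> j + card (b A) \<le> card K \<longrightarrow>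
       (\<exists>B. B \<subseteq> K \<and> b B = b A \<and> card B = j))"

lemma chain_bottomsD:
  assumes "chain_bottoms K b" "A \<subseteq> K"
  shows "b A \<subseteq> A" and "card A + card (b A) \<le> card K"
    and "B \<subseteq> K \<Longrightarrow> b A = b B \<Longrightarrow> A \<subseteq> B \<or> B \<subseteq> A"
    and "card (b A) \<le> j \<Longrightarrow> j + card (b A) \<le> card K \<Longrightarrow>
       \<exists>B. B \<subseteq> K \<and> b B = b A \<and> card B = j"
  using assms by (auto simp: chain_bottoms_def)

text \<open>
  The construction of de Bruijn, Tengbergen and Kruyswijk. A new point \<open>x\<close> turns a chain
  \<open>A\<^sub>k \<subset> \<dots> \<subset> A\<^sub>m\<close> into the two chains
  \<open>A\<^sub>k \<subset> \<dots> \<subset> A\<^sub>m \<subset> insert x A\<^sub>m\<close> and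
  \<open>insert x A\<^sub>k \<subset> \<dots> \<subset> insert x A\<^bsub>m-1\<^esub>\<close>,
  the second one being empty if \<open>k = m\<close>. Both are again symmetric. In terms of bottoms: adding
  \<open>x\<close> to a set keeps its bottom if the set is the top of its chain, and adds \<open>x\<close> to the bottom
  otherwise.
\<close>

lemma symmetric_chain_decomposition:
  assumes "finite K"
  shows "\<exists>b. chain_bottoms K b"
  using assms
proof (induction K rule: finite_induct)
  case empty
  show ?case
    by (rule exI[of _ id]) (auto simp: chain_bottoms_def)
next
  case (insert x K)
  then obtain b where b: "chain_bottoms K b"
    by blast
  note sub = chain_bottomsD(1)[OF b] and le = chain_bottomsD(2)[OF b]
    and comp = chain_bottomsD(3)[OF b] and sat = chain_bottomsD(4)[OF b]
  define top where "top A \<longleftrightarrow> card A + card (b A) = card K" for A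
  define b' where "b' A = (if x \<notin> A \<or> top (A - {x}) then b (A - {x}) else insert x (b (A - {x})))" for A
  have K: "finite K" "x \<notin> K" by fact+
  have fin: "finite A" if "A \<subseteq> K" for A
    using that K finite_subset by blast
  have x: "x \<notin> A" if "A \<subseteq> K" for A
    using that K by blast
  have b'_out: "b' A = b A" if "A \<subseteq> K" for A
    using x[OF that] by (simp add: b'_def)
  have b'_top: "b' (insert x A) = b A" if "A \<subseteq> K" "top A" for A
    using x[OF that(1)] that(2) by (simp add: b'_def)
  have b'_in: "b' (insert x A) = insert x (b A)" if "A \<subseteq> K" "\<not> top A" for A
    using x[OF that(1)] that(2) by (simp add: b'_def)
  have cards: "card (insert x A) = Suc (card A)" "card (insert x (b A)) = Suc (card (b A))"
    if "A \<subseteq> K" for A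
    using that K fin[OF that] finite_subset[OF sub[OF that] fin[OF that]] sub[OF that]
    by (auto simp: card_insert_if subset_iff)
  have cK: "card (insert x K) = Suc (card K)"
    using K by simp
  have cases: thesis
    if "A \<subseteq> insert x K" "A \<subseteq> K \<Longrightarrow> thesis"
      "\<And>A'. A' \<subseteq> K \<Longrightarrow> A = insert x A' \<Longrightarrow> top A' \<Longrightarrow> thesis"
      "\<And>A'. A' \<subseteq> K \<Longrightarrow> A = insert x A' \<Longrightarrow> \<not> top A' \<Longrightarrow> thesis" for A thesis
  proof (cases "x \<in> A")
    case True
    then have "A - {x} \<subseteq> K" "A = insert x (A - {x})"
      using that(1) by auto
    then show thesis
      using that(3,4) by blast
  qed (use that(1,2) in blast)
  \<comment> \<open>The largest size in a chain is attained only by a set that contains all the others.\<close>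
  have mixed: "A \<subseteq> B" if "A \<subseteq> K" "B \<subseteq> K" "top B" "b A = b B" for A B
    using comp[OF that(1,2,4)]
  proof
    assume "B \<subseteq> A"
    moreover have "card A \<le> card B"
      using le[OF that(1)] that(3,4) by (simp add: top_def)
    ultimately show ?thesis
      using card_seteq[OF fin[OF that(1)]] by blast
  qed
  have xb: "x \<notin> b A" if "A \<subseteq> K" for A
    using sub[OF that] that K by blast
  have "b' A \<subseteq> A \<and> card A + card (b' A) \<le> card (insert x K)" if "A \<subseteq> insert x K" for A
    using that
  proof (rule cases)
    assume "A \<subseteq> K"
    then show ?thesis
      using sub[of A] le[of A] by (simp add: b'_out cK)
  next
    fix A' assume "A' \<subseteq> K" "A = insert x A'" "top A'"
    then show ?thesis
      using sub[of A'] le[of A'] by (auto simp: b'_top cK cards)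
  next
    fix A' assume "A' \<subseteq> K" "A = insert x A'" "\<not> top A'"
    then show ?thesis
      using sub[of A'] le[of A'] by (auto simp: b'_in cK cards top_def)
  qed
  moreover have "A \<subseteq> B \<or> B \<subseteq> A" if "A \<subseteq> insert x K" "B \<subseteq> insert x K" "b' A = b' B" for A B
  proof -
    have ins: "insert x A' = insert x B' \<longleftrightarrow> A' = B'"
      if "x \<notin> A'" "x \<notin> B'" for A' B'
      using that by (rule insert_ident)
    show ?thesis
      using that(1)
    proof (rule cases)
      assume A: "A \<subseteq> K"
      show ?thesis using that(2)
      proof (rule cases)
        assume "B \<subseteq> K"
        then show ?thesis using A that(3) comp by (simp add: b'_out)
      next
        fix B' assume "B' \<subseteq> K" "B = insert x B'" "top B'"
        then show ?thesis using A that(3) mixed[of A B'] by (auto simp: b'_out b'_top)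
      next
        fix B' assume "B' \<subseteq> K" "B = insert x B'" "\<not> top B'"
        then show ?thesis using A that(3) xb[of A] by (auto simp: b'_out b'_in)
      qed
    next
      fix A' assume A: "A' \<subseteq> K" "A = insert x A'" "top A'"
      show ?thesis using that(2)
      proof (rule cases)
        assume "B \<subseteq> K"
        then show ?thesis using A that(3) mixed[of B A'] by (auto simp: b'_out b'_top)
      next
        fix B' assume "B' \<subseteq> K" "B = insert x B'" "top B'"
        then show ?thesis using A that(3) comp[of A' B'] by (auto simp: b'_top)
      next
        fix B' assume "B' \<subseteq> K" "B = insert x B'" "\<not> top B'"
        then show ?thesis using A that(3) xb[of A'] by (auto simp: b'_top b'_in)
      qed
    next
      fix A' assume A: "A' \<subseteq> K" "A = insert x A'" "\<not> top A'"
      show ?thesis using that(2)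
      proof (rule cases)
        assume "B \<subseteq> K"
        then show ?thesis using A that(3) xb[of B] by (auto simp: b'_out b'_in)
      next
        fix B' assume "B' \<subseteq> K" "B = insert x B'" "top B'"
        then show ?thesis using A that(3) xb[of B'] by (auto simp: b'_top b'_in)
      next
        fix B' assume "B' \<subseteq> K" "B = insert x B'" "\<not> top B'"
        then show ?thesis
          using A that(3) comp[of A' B'] ins[OF xb[of A'] xb[of B']] by (auto simp: b'_in)
      qed
    qed
  qed
  moreover have "\<exists>B. B \<subseteq> insert x K \<and> b' B = b' A \<and> card B = j"
    if "A \<subseteq> insert x K" "card (b' A) \<le> j" "j + card (b' A) \<le> card (insert x K)" for A j
  proof -
    \<comment> \<open>The extended chain: the only new size is one more than the largest old size.\<close>
    have long: "\<exists>B. B \<subseteq> insert x K \<and> b' B = b A' \<and> card B = j"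
      if A': "A' \<subseteq> K" and j: "card (b A') \<le> j" "j + card (b A') \<le> Suc (card K)" for A'
    proof (cases "j + card (b A') \<le> card K")
      case True
      then obtain B where "B \<subseteq> K" "b B = b A'" "card B = j"
        using sat[OF A' j(1)] by blast
      then show ?thesis
        by (intro exI[of _ B]) (auto simp: b'_out)
    next
      case False
      have "card (b A') \<le> card A'"
        using sub[OF A'] fin[OF A'] by (rule card_mono[rotated])
      then have "card (b A') \<le> card K - card (b A')" "card K - card (b A') + card (b A') = card K"
        using le[OF A'] by linarith+
      then obtain B where "B \<subseteq> K" "b B = b A'" "card B = card K - card (b A')"
        using sat[OF A', of "card K - card (b A')"] by auto
      moreover from this have "top B"
        using le[of B] \<open>card K - card (b A') + card (b A') = card K\<close> by (simp add: top_def)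
      ultimately show ?thesis
        using False j(2) \<open>card (b A') \<le> card K - card (b A')\<close>
        by (intro exI[of _ "insert x B"]) (auto simp: b'_top cards le_diff_conv)
    qed
    show ?thesis
      using that(1)
    proof (rule cases)
      assume "A \<subseteq> K"
      then show ?thesis using long[of A] that by (simp add: b'_out cK)
    next
      fix A' assume "A' \<subseteq> K" "A = insert x A'" "top A'"
      then show ?thesis using long[of A'] that by (simp add: b'_top cK)
    next
      fix A' assume A: "A' \<subseteq> K" "A = insert x A'" "\<not> top A'"
      then have j: "Suc (card (b A')) \<le> j" "j + Suc (card (b A')) \<le> Suc (card K)"
        using that(2,3) by (simp_all add: b'_in cK cards)
      then have "card (b A') \<le> j - 1" "j - 1 + card (b A') \<le> card K"
        by linarith+
      then obtain B where B: "B \<subseteq> K" "b B = b A'" "card B = j - 1"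
        using sat[OF A(1)] by blast
      then have "\<not> top B"
        using j by (simp add: top_def)
      then show ?thesis
        using A B j by (intro exI[of _ "insert x B"]) (auto simp: b'_in cards)
    qed
  qed
  ultimately show ?case
    unfolding chain_bottoms_def by (intro exI[of _ b']) blast
qed

text \<open>
  The colour of a set is the number of its symmetric chain. The bound on the number of chains holds
  because a chain with smallest size \<open>k\<close> has \<open>k \<le> card K div 2 \<le> card K - k\<close>, so that
  every bottom is already the bottom of a set of size \<open>card K div 2\<close>.
\<close>

lemma chain_colouring_of_subsets:
  fixes K :: "'a set"
  assumes "finite K"
  obtains c :: "'a set \<Rightarrow> nat" where
    "\<And>A. A \<subseteq> K \<Longrightarrow> c A < card K choose (card K div 2)"
    "\<And>A B. A \<subseteq> K \<Longrightarrow> B \<subseteq> K \<Longrightarrow> c A = c B \<Longrightarrow> A \<subseteq> B \<or> B \<subseteq> A"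
proof -
  obtain b where b: "chain_bottoms K b"
    using symmetric_chain_decomposition[OF assms] by blast
  note sub = chain_bottomsD(1)[OF b] and le = chain_bottomsD(2)[OF b]
    and comp = chain_bottomsD(3)[OF b] and sat = chain_bottomsD(4)[OF b]
  let ?M = "{B. B \<subseteq> K \<and> card B = card K div 2}"
  have "b ` Pow K \<subseteq> b ` ?M"
  proof clarify
    fix A assume A: "A \<subseteq> K"
    have "card (b A) \<le> card A"
      using sub[OF A] finite_subset[OF A assms] by (rule card_mono[rotated])
    then have "card (b A) \<le> card K div 2" "card K div 2 + card (b A) \<le> card K"
      using le[OF A] by linarith+
    then obtain B where "B \<subseteq> K" "b B = b A" "card B = card K div 2"
      using sat[OF A] by blast
    then show "b A \<in> b ` ?M"
      by (metis (mono_tags, lifting) image_eqI mem_Collect_eq)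
  qed
  then have "card (b ` Pow K) \<le> card (b ` ?M)"
    using assms by (intro card_mono) auto
  also have "\<dots> \<le> card ?M"
    using assms by (intro card_image_le) auto
  also have "\<dots> = card K choose (card K div 2)"
    using assms by (rule n_subsets)
  finally have small: "card (b ` Pow K) \<le> card K choose (card K div 2)" .
  obtain h :: "'a set \<Rightarrow> nat" where h: "bij_betw h (b ` Pow K) {0..<card (b ` Pow K)}"
    using ex_bij_betw_finite_nat[of "b ` Pow K"] assms by auto
  show ?thesis
  proof (rule that[of "h \<circ> b"])
    show "(h \<circ> b) A < card K choose (card K div 2)" if "A \<subseteq> K" for A
    proof -
      have "h (b A) \<in> {0..<card (b ` Pow K)}"
        using that by (intro bij_betw_apply[OF h]) blast
      then show ?thesis
        using small by simp
    qed
    show "A \<subseteq> B \<or> B \<subseteq> A" if "A \<subseteq> K" "B \<subseteq> K" "(h \<circ> b) A = (h \<circ> b) B" for A B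
    proof (rule comp[OF that(1,2)])
      show "b A = b B"
        by (rule inj_onD[OF bij_betw_imp_inj_on[OF h]]) (use that in simp_all)
    qed
  qed
qed

section \<open>Functions of finite support and their cozero sets\<close>

definition cozero_set :: "'a topology \<Rightarrow> ('a \<Rightarrow> real) \<Rightarrow> 'a set" where
  "cozero_set X f = {x \<in> topspace X. f x \<noteq> 0}"

lemma finite_openin_isolated:
  assumes "t1_space X" "openin X U" "finite U"
  shows "U \<subseteq> isolated_points X"
proof
  fix x assume x: "x \<in> U"
  have "closedin X (U - {x})"
    using assms openin_subset[OF assms(2)] by (auto simp: t1_space_closedin_finite)
  then have "openin X (U - (U - {x}))"
    using assms(2) by blast
  then show "x \<in> isolated_points X"
    using x openin_subset[OF assms(2)] by (auto simp: isolated_points_def Diff_Diff_Int)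
qed

text \<open>
  The cozero set of a continuous function is open, so it consists of isolated points once it is
  finite. Conversely, a function that vanishes outside a finite set of isolated points is
  continuous: the preimage of an open set is cofinite if the open set contains
  \<open>0\<close>, and otherwise it is a union of isolated points.
\<close>

lemma finite_support_functions_iff:
  assumes "t1_space X"
  shows "f \<in> finite_support_functions X \<longleftrightarrow>
    f \<in> extensional (topspace X) \<and> finite (cozero_set X f) \<and> cozero_set X f \<subseteq> isolated_points X"
proof -
  have coz: "topspace X - zero_set X f = cozero_set X f"
    by (auto simp: zero_set_def cozero_set_def)
  have "cozero_set X f \<subseteq> isolated_points X"
    if "continuous_map X euclideanreal f" "finite (cozero_set X f)"
  proof -
    have "openin X {x \<in> topspace X. f x \<in> - {0}}"
      using that(1) by (rule openin_continuous_map_preimage) auto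
    then show ?thesis
      using finite_openin_isolated[OF assms _ that(2)] by (simp add: cozero_set_def)
  qed
  moreover have "continuous_map X euclideanreal f"
    if "finite (cozero_set X f)" "cozero_set X f \<subseteq> isolated_points X"
    unfolding continuous_map_def
  proof (intro conjI allI impI)
    fix U :: "real set" assume "openin euclideanreal U"
    show "openin X {x \<in> topspace X. f x \<in> U}"
    proof (cases "0 \<in> U")
      case True
      have "finite {x \<in> topspace X. f x \<notin> U}"
        by (rule finite_subset[OF _ that(1)]) (use True in \<open>auto simp: cozero_set_def\<close>)
      then have "closedin X {x \<in> topspace X. f x \<notin> U}"
        using assms by (auto simp: t1_space_closedin_finite)
      then have "openin X (topspace X - {x \<in> topspace X. f x \<notin> U})"
        by blast
      also have "topspace X - {x \<in> topspace X. f x \<notin> U} = {x \<in> topspace X. f x \<in> U}"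
        by auto
      finally show ?thesis .
    next
      case False
      then have "{x \<in> topspace X. f x \<in> U} \<subseteq> isolated_points X"
        using that(2) by (auto simp: cozero_set_def)
      then show ?thesis
        by (subst openin_subopen) (force simp: isolated_points_def)
    qed
  qed auto
  ultimately show ?thesis
    unfolding finite_support_functions_def continuous_functions_ring_def by (auto simp: coz)
qed

lemma indicator_finite_support:
  assumes "t1_space X" "finite A" "A \<subseteq> isolated_points X"
  shows "(\<lambda>x\<in>topspace X. indicator A x) \<in> finite_support_functions X"
    and "cozero_set X (\<lambda>x\<in>topspace X. indicator A x) = A"
proof -
  show "cozero_set X (\<lambda>x\<in>topspace X. indicator A x) = A"
    using assms(3) by (auto simp: cozero_set_def isolated_points_def indicator_def)
  then show "(\<lambda>x\<in>topspace X. indicator A x) \<in> finite_support_functions X"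
    using assms by (simp add: finite_support_functions_iff)
qed

lemma isolated_points_interior_zero_set:
  "X interior_of (zero_set X f) \<inter> isolated_points X = isolated_points X - cozero_set X f"
proof -
  have "x \<in> X interior_of (zero_set X f)" if "x \<in> isolated_points X" "f x = 0" for x
    unfolding interior_of_def using that
    by (auto intro!: exI[of _ "{x}"] simp: isolated_points_def zero_set_def)
  moreover have "f x = 0" if "x \<in> X interior_of (zero_set X f)" for x
    using that interior_of_subset[of X "zero_set X f"] by (auto simp: zero_set_def)
  ultimately show ?thesis
    by (auto simp: cozero_set_def isolated_points_def)
qed

text \<open>
  A cozero set is the complement within the isolated points of the set that defines the
  equivalence of functions, so the cozero set is a complete invariant of an equivalence class.
  Indicator functions show that every finite set of isolated points occurs.
\<close>

lemma CF_representatives_cozero: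
  assumes "t1_space X" "CF_representatives X S"
  shows "inj_on (cozero_set X) S"
    and "A \<subseteq> isolated_points X \<Longrightarrow> finite A \<Longrightarrow> \<exists>f\<in>S. cozero_set X f = A"
proof -
  have S: "S \<subseteq> finite_support_functions X"
    and ex1: "\<And>E. E \<in> finite_support_functions X // CF_equiv X \<Longrightarrow> \<exists>!f. f \<in> S \<inter> E"
    using assms(2) by (auto simp: CF_representatives_def)
  have equiv: "(f, g) \<in> CF_equiv X \<longleftrightarrow> cozero_set X f = cozero_set X g"
    if "f \<in> finite_support_functions X" "g \<in> finite_support_functions X" for f g
    using that assms(1) unfolding CF_equiv_def isolated_points_interior_zero_set
    by (auto simp: finite_support_functions_iff)
  show "inj_on (cozero_set X) S"
  proof (rule inj_onI)
    fix f g assume fg: "f \<in> S" "g \<in> S" "cozero_set X f = cozero_set X g"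
    then have "CF_equiv X `` {f} \<in> finite_support_functions X // CF_equiv X"
      using S by (blast intro: quotientI)
    moreover have "(f, f) \<in> CF_equiv X" "(f, g) \<in> CF_equiv X"
      using fg S equiv[of f f] equiv[of f g] by auto
    ultimately show "f = g"
      using ex1 fg(1,2) by blast
  qed
  assume A: "A \<subseteq> isolated_points X" "finite A"
  let ?i = "\<lambda>x\<in>topspace X. indicator A x :: real"
  note i = indicator_finite_support[OF assms(1) A(2,1)]
  have "CF_equiv X `` {?i} \<in> finite_support_functions X // CF_equiv X"
    using i by (blast intro: quotientI)
  then obtain f where f: "f \<in> S" "(?i, f) \<in> CF_equiv X"
    using ex1 by blast
  then show "\<exists>f\<in>S. cozero_set X f = A"
    using equiv[OF i(1)] S i(2) by auto
qed

section \<open>Adjacency as incomparability of cozero sets\<close>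

lemma CF_ring_simps:
  "carrier (CF_ring X) = finite_support_functions X"
  "f \<otimes>\<^bsub>CF_ring X\<^esub> g = (\<lambda>x\<in>topspace X. f x * g x)"
  "\<zero>\<^bsub>CF_ring X\<^esub> = (\<lambda>x\<in>topspace X. 0)"
  by (simp_all add: CF_ring_def continuous_functions_ring_def)

lemma cozero_mult: "cozero_set X (f \<otimes>\<^bsub>CF_ring X\<^esub> g) = cozero_set X f \<inter> cozero_set X g"
  by (auto simp: cozero_set_def CF_ring_simps)

lemma mult_eq_zero_iff:
  "f \<otimes>\<^bsub>CF_ring X\<^esub> g = \<zero>\<^bsub>CF_ring X\<^esub> \<longleftrightarrow> cozero_set X f \<inter> cozero_set X g = {}"
  by (auto simp: cozero_set_def CF_ring_simps fun_eq_iff restrict_def)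

lemma eq_zero_iff:
  assumes "f \<in> finite_support_functions X"
  shows "f = \<zero>\<^bsub>CF_ring X\<^esub> \<longleftrightarrow> cozero_set X f = {}"
  using assms
  by (auto simp: cozero_set_def CF_ring_simps fun_eq_iff finite_support_functions_def
      continuous_functions_ring_def extensional_def)

lemma annihilator_CF_ring:
  "annihilator (CF_ring X) f = {r \<in> finite_support_functions X. cozero_set X r \<inter> cozero_set X f = {}}"
  by (auto simp: annihilator_def mult_eq_zero_iff CF_ring_simps(1))

text \<open>
  If \<open>x\<close> lies only in the cozero set of \<open>f\<close> and \<open>y\<close> only in that of \<open>g\<close>, then the indicator
  of \<open>{x, y}\<close> annihilates \<open>f g\<close> but neither of the factors. If one cozero set contains the other,
  then \<open>f g\<close> has the smaller one as its cozero set, and hence the larger annihilator.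
\<close>

lemma annihilator_mult_eq_Un_iff:
  assumes "t1_space X" "f \<in> finite_support_functions X" "g \<in> finite_support_functions X"
  shows "annihilator (CF_ring X) f \<union> annihilator (CF_ring X) g = annihilator (CF_ring X) (f \<otimes>\<^bsub>CF_ring X\<^esub> g)
    \<longleftrightarrow> cozero_set X f \<subseteq> cozero_set X g \<or> cozero_set X g \<subseteq> cozero_set X f"
proof
  assume eq: "annihilator (CF_ring X) f \<union> annihilator (CF_ring X) g =
    annihilator (CF_ring X) (f \<otimes>\<^bsub>CF_ring X\<^esub> g)"
  show "cozero_set X f \<subseteq> cozero_set X g \<or> cozero_set X g \<subseteq> cozero_set X f"
  proof (rule ccontr)
    assume "\<not> ?thesis"
    then obtain x y where xy: "x \<in> cozero_set X f" "x \<notin> cozero_set X g"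
      "y \<in> cozero_set X g" "y \<notin> cozero_set X f"
      by blast
    then have iso: "{x, y} \<subseteq> isolated_points X"
      using assms by (auto simp: finite_support_functions_iff)
    let ?i = "\<lambda>z\<in>topspace X. indicator {x, y} z :: real"
    note i = indicator_finite_support[OF assms(1) _ iso]
    have "?i \<in> annihilator (CF_ring X) (f \<otimes>\<^bsub>CF_ring X\<^esub> g)"
      using i xy by (auto simp: annihilator_CF_ring cozero_mult)
    moreover have "?i \<notin> annihilator (CF_ring X) f" "?i \<notin> annihilator (CF_ring X) g"
      using i xy by (auto simp: annihilator_CF_ring)
    ultimately show False
      using eq by blast
  qed
qed (auto simp: annihilator_CF_ring cozero_mult)

lemma CF_vertices_iff:
  assumes "t1_space X" "CF_representatives X S"
  shows "f \<in> CF_vertices X S \<longleftrightarrow>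
    f \<in> S \<and> cozero_set X f \<noteq> {} \<and> cozero_set X f \<subset> isolated_points X"
proof (cases "f \<in> S")
  case True
  then have f: "f \<in> finite_support_functions X"
    using assms(2) by (auto simp: CF_representatives_def)
  then have "cozero_set X f \<subseteq> isolated_points X"
    using assms(1) by (simp add: finite_support_functions_iff)
  then show ?thesis
    using True eq_zero_iff[OF f] by (auto simp: CF_vertices_def isolated_points_interior_zero_set)
qed (simp add: CF_vertices_def)

text \<open>
  The indicator of an isolated point outside the cozero set is a nonzero cofactor. Without this inclusion
  the induced subgraph could lack arcs, since the arcs of the annihilator graph join zero divisors.
\<close>

lemma CF_vertices_zero_divisors:
  assumes "t1_space X" "CF_representatives X S"
  shows "CF_vertices X S \<subseteq> nonzero_zero_divisors (CF_ring X)"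
proof
  fix f assume f: "f \<in> CF_vertices X S"
  then have S: "f \<in> finite_support_functions X" "cozero_set X f \<noteq> {}"
    using assms(2) by (auto simp: CF_vertices_iff[OF assms] CF_representatives_def)
  obtain x where x: "x \<in> isolated_points X" "x \<notin> cozero_set X f"
    using f by (auto simp: CF_vertices_iff[OF assms])
  let ?i = "\<lambda>z\<in>topspace X. indicator {x} z :: real"
  have i: "?i \<in> finite_support_functions X" "cozero_set X ?i = {x}"
    using indicator_finite_support[OF assms(1), of "{x}"] x by auto
  then have "?i \<noteq> \<zero>\<^bsub>CF_ring X\<^esub>" "f \<otimes>\<^bsub>CF_ring X\<^esub> ?i = \<zero>\<^bsub>CF_ring X\<^esub>"
    using x(2) by (auto simp: eq_zero_iff mult_eq_zero_iff)
  then show "f \<in> nonzero_zero_divisors (CF_ring X)"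
    using S i(1) by (auto simp: nonzero_zero_divisors_def CF_ring_simps(1) eq_zero_iff)
qed

lemma verts_CF_graph: "verts (CF_graph X S) = CF_vertices X S"
  by (simp add: CF_graph_def)

lemma CF_graph_adjacent_iff:
  assumes "t1_space X" "CF_representatives X S" "f \<in> CF_vertices X S" "g \<in> CF_vertices X S"
  shows "f \<rightarrow>\<^bsub>CF_graph X S\<^esub> g \<longleftrightarrow>
    \<not> (cozero_set X f \<subseteq> cozero_set X g \<or> cozero_set X g \<subseteq> cozero_set X f)"
proof -
  have "f \<in> finite_support_functions X" "g \<in> finite_support_functions X"
    using assms(2-4) by (auto simp: CF_vertices_def CF_representatives_def)
  note ann = annihilator_mult_eq_Un_iff[OF assms(1) this]
  have "f \<rightarrow>\<^bsub>CF_graph X S\<^esub> g \<longleftrightarrow> f \<noteq> g \<and> annihilator (CF_ring X) f \<union> annihilator (CF_ring X) g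
      \<noteq> annihilator (CF_ring X) (f \<otimes>\<^bsub>CF_ring X\<^esub> g)"
    using assms(3,4) CF_vertices_zero_divisors[OF assms(1,2)]
    by (auto simp: CF_graph_def annihilator_graph_def induce_subgraph_def arcs_ends_def arc_to_ends_def)
  then show ?thesis
    unfolding ann by blast
qed

section \<open>The chromatic number\<close>

theorem theorem5p4:
  fixes X :: "'a topology" and S :: "('a \<Rightarrow> real) set"
  assumes "completely_regular_space X" and "Hausdorff_space X"
    and "finite (isolated_points X)"
    and "card (isolated_points X) \<ge> 3"
    and "CF_representatives X S"
  shows "chromatic_number (CF_graph X S) =o
           |{..< card (isolated_points X) choose (card (isolated_points X) div 2)}|"
proof -
  let ?G = "CF_graph X S" and ?K = "isolated_points X"
  let ?N = "card ?K choose (card ?K div 2)"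
  let ?M = "{A. A \<subseteq> ?K \<and> card A = card ?K div 2}"
  have t1: "t1_space X"
    using assms(2) by (rule Hausdorff_imp_t1_space)
  note vertex = CF_vertices_iff[OF t1 assms(5)] and adj = CF_graph_adjacent_iff[OF t1 assms(5)]
    and reps = CF_representatives_cozero[OF t1 assms(5)]
  have loopfree: "\<not> f \<rightarrow>\<^bsub>?G\<^esub> f" if "f \<in> verts ?G" for f
    using that by (simp add: adj verts_CF_graph)

  obtain c :: "'a set \<Rightarrow> nat" where
    c: "\<And>A. A \<subseteq> ?K \<Longrightarrow> c A < ?N"
      "\<And>A B. A \<subseteq> ?K \<Longrightarrow> B \<subseteq> ?K \<Longrightarrow> c A = c B \<Longrightarrow> A \<subseteq> B \<or> B \<subseteq> A"
    using chain_colouring_of_subsets[OF assms(3)] by blast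
  have "colourable_with ?G |{..<?N}|"
    unfolding colourable_with_def
  proof (intro bexI[of _ "c \<circ> cozero_set X"] ballI impI)
    show "c \<circ> cozero_set X \<in> verts ?G \<rightarrow> Field |{..<?N}|"
      using c(1) by (auto simp: verts_CF_graph vertex Field_card_of)
    fix f g assume "f \<in> verts ?G" "g \<in> verts ?G" "f \<rightarrow>\<^bsub>?G\<^esub> g"
    then show "(c \<circ> cozero_set X) f \<noteq> (c \<circ> cozero_set X) g"
      using c(2)[of "cozero_set X f" "cozero_set X g"]
      by (auto simp: verts_CF_graph adj vertex)
  qed
  then have upper: "chromatic_number ?G \<le>o |{..<?N}|"
    by (intro chromatic_number_least loopfree card_of_Card_order)

  \<comment> \<open>\<open>r\<close> carries the sets of middle size to vertices. As there are at least three isolated points,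
    these sets are nonempty and proper.\<close>
  define r where "r A = inv_into S (cozero_set X) A" for A
  have r: "r A \<in> CF_vertices X S" "cozero_set X (r A) = A" if "A \<in> ?M" for A
  proof -
    have "finite A"
      using that assms(3) finite_subset by blast
    then have "A \<in> cozero_set X ` S"
      using that reps(2)[of A] by blast
    then show coz: "cozero_set X (r A) = A" and "r A \<in> CF_vertices X S"
      using that assms(4) by (auto simp: r_def vertex f_inv_into_f inv_into_into)
  qed
  obtain k where k: "k \<in> verts ?G \<rightarrow> Field (chromatic_number ?G)"
      "\<And>f g. f \<in> verts ?G \<Longrightarrow> g \<in> verts ?G \<Longrightarrow> f \<rightarrow>\<^bsub>?G\<^esub> g \<Longrightarrow> k f \<noteq> k g"
    using chromatic_number_props(2)[OF loopfree] unfolding colourable_with_def by blast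
  have "inj_on (k \<circ> r) ?M"
  proof (rule inj_onI)
    fix A B assume AB: "A \<in> ?M" "B \<in> ?M" "(k \<circ> r) A = (k \<circ> r) B"
    then have "\<not> r A \<rightarrow>\<^bsub>?G\<^esub> r B"
      using k(2)[of "r A" "r B"] r by (auto simp: verts_CF_graph)
    then have "A \<subseteq> B \<or> B \<subseteq> A"
      using AB r by (simp add: adj)
    moreover have "finite A" "finite B" "card A = card B"
      using AB assms(3) finite_subset by auto
    ultimately show "A = B"
      by (metis card_subset_eq)
  qed
  moreover have "(k \<circ> r) ` ?M \<subseteq> Field (chromatic_number ?G)"
    using k(1) r(1) by (auto simp: verts_CF_graph)
  ultimately have "|?M| \<le>o |Field (chromatic_number ?G)|"
    using card_of_ordLeq by blast
  moreover have "|Field (chromatic_number ?G)| =o chromatic_number ?G"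
    by (rule card_of_Field_ordIso[OF chromatic_number_props(1)[OF loopfree]])
  moreover have "|{..<?N}| =o |?M|"
    using assms(3) finite_same_card_bij[of "{..<?N}" ?M] card_of_ordIso[of "{..<?N}" ?M]
    by (simp add: n_subsets)
  ultimately have "|{..<?N}| \<le>o chromatic_number ?G"
    by (meson ordIso_ordLeq_trans ordLeq_ordIso_trans)
  with upper show ?thesis
    by (simp add: ordIso_iff_ordLeq)
qed

end
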